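(* Let $Y\sim\Gamma(1,1)$. For all integers $n\ge k\ge 0$, $$S_{1,\lambda}^{Y}(n,k)=\sum_{l=k}^{n}(-1)^{n-l}S_{1,\lambda}(l,k)S_{1}(n,l)\lambda^{n-l}.$$ In particular, $$\lim_{\lambda\rightarrow 0}S_{1,\lambda}^{Y}(n,k)=S_{1}(n,k).$$
   Context: $\lambda$ is a nonzero real number. $\Gamma(1,1)$ is the gamma distribution with parameters $\alpha=\beta=1$, i.e. with density $e^{-y}$ for $y\ge0$ and $0$ for $y<0$. For real $x$ and $n\ge1$: $(x)_{n}=x(x-1)\cdots(x-n+1)$, $(x)_{n,\lambda}=x(x-\lambda)\cdots(x-(n-1)\lambda)$, and $(x)_0=(x)_{0,\lambda}=1$. The (signed) Stirling numbers of the first kind $S_1(n,k)$ and the degenerate Stirling numbers of the first kind $S_{1,\lambda}(n,k)$ (no superscript) are defined by the polynomial identities $(x)_n=\sum_{k=0}^nS_1(n,k)x^k$ and $(x)_{n}=\sum_{k=0}^nS_{1,\lambda}(n,k)(x)_{k,\lambda}$, $n\ge0$. The degenerate exponential is $e_{\lambda}^{x}(t)=(1+\lambda t)^{x/\lambda}=\sum_{n\ge0}(x)_{n,\lambda}\frac{t^n}{n!}$, and $E[e_{\lambda}^{Y}(t)]=\sum_{n\ge0}E[(Y)_{n,\lambda}]\frac{t^n}{n!}$ for $t$ near $0$. The degenerate logarithm is, for $\mu\ne0$ and $u>0$, $\log_{\mu}(u)=\frac{1}{\mu}(u^{\mu}-1)$; in particular $\log_{-\lambda}(u)=-\frac1\lambda(u^{-\lambda}-1)$.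 The probabilistic degenerate Stirling numbers of the first kind associated with $Y$ are defined by the power series expansion at $t=0$: $\frac{1}{k!}\big(\log_{-\lambda}(E[e_{\lambda}^{Y}(t)])\big)^k=\sum_{n\ge k}(-1)^{n-k}S_{1,\lambda}^{Y}(n,k)\frac{t^n}{n!}$, $k\ge0$. *)

theory Defs
  imports "HOL-Probability.Probability"
begin

definition falling :: "real \<Rightarrow> nat \<Rightarrow> real" where
  "falling x n = (\<Prod>i<n. x - of_nat i)"

definition deg_falling :: "real \<Rightarrow> real \<Rightarrow> nat \<Rightarrow> real" where
  "deg_falling lam x n = (\<Prod>i<n. x - of_nat i * lam)"

(* For each fixed n, both kinds of Stirling numbers are the unique coefficient sequence
   k \<mapsto> a k of an expansion of (x)_n; the requirement a k = 0 for k > n pins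
   down the entries that do not occur in the expansion. *)

definition stirling1 :: "nat \<Rightarrow> nat \<Rightarrow> real" where
  "stirling1 n =
    (THE a. (\<forall>k>n. a k = 0) \<and> (\<forall>x. falling x n = (\<Sum>k\<le>n. a k * x ^ k)))"

definition deg_stirling1 :: "real \<Rightarrow> nat \<Rightarrow> nat \<Rightarrow> real" where
  "deg_stirling1 lam n =
    (THE a. (\<forall>k>n. a k = 0) \<and>
            (\<forall>x. falling x n = (\<Sum>k\<le>n. a k * deg_falling lam x k)))"

definition deg_exp :: "real \<Rightarrow> real \<Rightarrow> real \<Rightarrow> real" where
  "deg_exp lam x t = (1 + lam * t) powr (x / lam)"

definition deg_log :: "real \<Rightarrow> real \<Rightarrow> real" where
  "deg_log mu u = 1 / mu * (u powr mu - 1)"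

(* Here k is fixed and the unknown is the sequence n \<mapsto> a n. The terms with n < k vanish, so
   the series below is the one starting at n = k (where natural subtraction is exact). *)

definition prob_deg_stirling1 ::
  "'a measure \<Rightarrow> ('a \<Rightarrow> real) \<Rightarrow> real \<Rightarrow> nat \<Rightarrow> nat \<Rightarrow> real" where
  "prob_deg_stirling1 M Y lam n k =
    (THE a. (\<forall>n<k. a n = 0) \<and>
            (\<forall>\<^sub>F t in nhds 0.
               (\<lambda>n. (- 1) ^ (n - k) * a n * t ^ n / fact n) sums
               (1 / fact k *
                 deg_log (- lam) (prob_space.expectation M (\<lambda>\<omega>. deg_exp lam (Y \<omega>) t)) ^ k))) n"

end

theory Submission
  imports Defs "HOL-Complex_Analysis.Complex_Analysis"
begin

text \<open>
  For \<open>Y\<close> exponential, \<open>E[e\<^sub>\<lambda>\<^sup>Y(t)] = 1 / (1 - s)\<close> with \<open>s = ln (1 + \<lambda> t) / \<lambda>\<close>, so the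
  generating function of the probabilistic Stirling numbers is \<open>(- g (- s)) ^ k / k!\<close> where
  \<open>g u = ((1 + u) powr \<lambda> - 1) / \<lambda>\<close>. The powers \<open>g ^ k / k!\<close> and \<open>(ln (1 + u)) ^ k / k!\<close>
  generate the degenerate and the ordinary Stirling numbers of the first kind, so the formula is
  the coefficient of a composition of power series. Both kinds of numbers satisfy one recurrence
  that is polynomial in \<open>\<lambda>\<close>, the ordinary ones being the case \<open>\<lambda> = 0\<close>; hence the limit.
\<close>

section \<open>Recurrence for the Stirling numbers of the first kind\<close>

text \<open>The recurrence comes from x - n = (x - k lam) + (k lam - n): multiplying
  \<open>deg_falling lam x k\<close> by the first summand raises the index k by one, the second is a
  scalar. The test for \<open>k = 0\<close> is needed because natural subtraction truncates
  \<open>k - 1\<close> to 0.\<close>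

fun stirling1_rec :: "real \<Rightarrow> nat \<Rightarrow> nat \<Rightarrow> real" where
  "stirling1_rec lam 0 k = (if k = 0 then 1 else 0)"
| "stirling1_rec lam (Suc n) k =
     (if k = 0 then 0 else stirling1_rec lam n (k - 1))
       + (of_nat k * lam - of_nat n) * stirling1_rec lam n k"

lemma stirling1_rec_eq_0: "n < k \<Longrightarrow> stirling1_rec lam n k = 0"
  by (induction n arbitrary: k) auto

lemma falling_eq_sum_deg_falling:
  "falling x n = (\<Sum>k\<le>n. stirling1_rec lam n k * deg_falling lam x k)"
proof (induction n)
  case 0
  show ?case by (simp add: falling_def deg_falling_def)
next
  case (Suc n)
  have step: "deg_falling lam x k * (x - of_nat n)
      = deg_falling lam x (Suc k) + (of_nat k * lam - of_nat n) * deg_falling lam x k" for k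
    by (simp add: deg_falling_def algebra_simps)
  have "falling x (Suc n) = falling x n * (x - of_nat n)"
    by (simp add: falling_def)
  also have "\<dots> = (\<Sum>k\<le>n. stirling1_rec lam n k * (deg_falling lam x k * (x - of_nat n)))"
    unfolding Suc.IH by (simp add: sum_distrib_right mult.assoc)
  also have "\<dots> = (\<Sum>k\<le>n. stirling1_rec lam n k * deg_falling lam x (Suc k))
      + (\<Sum>k\<le>n. (of_nat k * lam - of_nat n) * stirling1_rec lam n k * deg_falling lam x k)"
    unfolding step by (simp add: algebra_simps flip: sum.distrib)
  also have "(\<Sum>k\<le>n. stirling1_rec lam n k * deg_falling lam x (Suc k))
      = (\<Sum>k\<le>Suc n. (if k = 0 then 0 else stirling1_rec lam n (k - 1)) * deg_falling lam x k)"
    by (subst sum.atMost_Suc_shift) simp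
  \<comment> \<open>The added term \<open>k = Suc n\<close> is zero, so both sums get the same
    range.\<close>
  also have "(\<Sum>k\<le>n. (of_nat k * lam - of_nat n) * stirling1_rec lam n k * deg_falling lam x k)
      = (\<Sum>k\<le>Suc n. (of_nat k * lam - of_nat n) * stirling1_rec lam n k * deg_falling lam x k)"
    by (simp add: stirling1_rec_eq_0)
  finally show ?case
    by (simp add: sum.distrib distrib_right del: sum.atMost_Suc)
qed

text \<open>As a function of x, \<open>deg_falling lam x k\<close> is a monic polynomial of degree
  k. A combination vanishing at all reals is the zero polynomial, so its top coefficient
  \<open>c n\<close> is 0 and induction removes the rest.\<close>

lemma deg_falling_independent:
  assumes "\<And>x. (\<Sum>k\<le>n. c k * deg_falling lam x k) = 0" and "k \<le> n"
  shows "c k = 0"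
  using assms
proof (induction n arbitrary: k)
  case 0
  then show ?case by (simp add: deg_falling_def)
next
  case (Suc n)
  define P where "P = (\<lambda>k. \<Prod>i<k. [:- (of_nat i * lam), 1:])"
  have poly_P: "poly (P k) x = deg_falling lam x k" for k x
    by (simp add: P_def deg_falling_def poly_prod)
  have deg_P: "degree (P k) = k" for k
    unfolding P_def by (subst degree_prod_eq_sum_degree) auto
  have "lead_coeff (P (Suc n)) = 1"
    unfolding P_def by (simp only: lead_coeff_prod) simp
  then have top: "coeff (P (Suc n)) (Suc n) = 1"
    by (simp only: deg_P)
  define p where "p = (\<Sum>k\<le>Suc n. smult (c k) (P k))"
  have "poly p x = 0" for x
    using Suc.prems(1)[of x] by (simp add: p_def poly_sum poly_P)
  then have "p = 0"
    using poly_all_0_iff_0 by blast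
  moreover have "coeff p (Suc n) = c (Suc n)"
    by (simp add: p_def coeff_sum top coeff_eq_0 deg_P)
  ultimately have "c (Suc n) = 0" by simp
  then show ?case
    using Suc.IH[of k] Suc.prems by (cases "k = Suc n") auto
qed

lemma deg_stirling1_eq_rec: "deg_stirling1 lam = stirling1_rec lam"
proof
  fix n
  show "deg_stirling1 lam n = stirling1_rec lam n"
    unfolding deg_stirling1_def
  proof (rule the_equality)
    show "(\<forall>k>n. stirling1_rec lam n k = 0) \<and>
      (\<forall>x. falling x n = (\<Sum>k\<le>n. stirling1_rec lam n k * deg_falling lam x k))"
      using stirling1_rec_eq_0 falling_eq_sum_deg_falling by blast
  next
    fix a
    assume a: "(\<forall>k>n. a k = 0) \<and> (\<forall>x. falling x n = (\<Sum>k\<le>n. a k * deg_falling lam x k))"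
    have "a k - stirling1_rec lam n k = 0" if "k \<le> n" for k
    proof (rule deg_falling_independent[OF _ that])
      show "(\<Sum>k\<le>n. (a k - stirling1_rec lam n k) * deg_falling lam x k) = 0" for x
        using a falling_eq_sum_deg_falling[of x n lam]
        by (simp add: left_diff_distrib sum_subtractf)
    qed
    then show "a = stirling1_rec lam n"
      using a stirling1_rec_eq_0 by (metis eq_iff_diff_eq_0 ext not_less)
  qed
qed

text \<open>At \<open>lam = 0\<close> the basis \<open>deg_falling lam x k\<close> becomes the
  powers of x, so the two definite descriptions coincide.\<close>

lemma stirling1_eq_rec: "stirling1 = stirling1_rec 0"
  unfolding deg_stirling1_eq_rec[symmetric]
  by (simp add: fun_eq_iff stirling1_def deg_stirling1_def deg_falling_def)

section \<open>Powers of formal power series as generating functions\<close>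

text \<open>The differential equation covers both \<open>g = ((1 + X) powr lam - 1) / lam\<close> and, for
  \<open>lam = 0\<close>, \<open>g = ln (1 + X)\<close>.\<close>

lemma fps_nth_power_stirling1_rec:
  fixes g :: "complex fps"
  assumes g0: "fps_nth g 0 = 0"
    and ode: "(1 + fps_X) * fps_deriv g = 1 + fps_const (of_real lam) * g"
  shows "fps_nth (g ^ k) n = of_real (stirling1_rec lam n k) * fact k / fact n"
proof (induction n arbitrary: k)
  case 0
  show ?case using g0 by (simp add: fps_power_zeroth power_0_left)
next
  case (Suc n)
  show ?case
  proof (cases k)
    case 0
    have "stirling1_rec lam n 0 = 0 \<or> n = 0" by (induction n) auto
    then show ?thesis using 0 by auto
  next
    case (Suc j)
    have "(1 + fps_X) * fps_deriv (g ^ k)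
        = of_nat k * g ^ j * ((1 + fps_X) * fps_deriv g)"
      by (simp add: fps_deriv_power Suc fps_of_nat[symmetric] mult_ac del: power_Suc of_nat_Suc)
    also have "\<dots> = of_nat k * (g ^ j + fps_const (of_real lam) * g ^ k)"
      unfolding ode by (simp add: Suc algebra_simps)
    \<comment> \<open>Comparing coefficients of index n in (1 + X) (g^k)' = k (g^j + lam g^k) gives
      the recurrence, up to the factor k! / n!.\<close>
    finally have "fps_nth (fps_deriv (g ^ k) + fps_X * fps_deriv (g ^ k)) n
        = fps_nth (fps_const (of_nat k) * (g ^ j + fps_const (of_real lam) * g ^ k)) n"
      by (simp add: distrib_right fps_of_nat)
    moreover have "fps_nth (fps_X * fps_deriv (g ^ k)) n = of_nat n * fps_nth (g ^ k) n"
      by (cases n) auto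
    ultimately have "of_nat (Suc n) * fps_nth (g ^ k) (Suc n) + of_nat n * fps_nth (g ^ k) n
        = of_nat k * (fps_nth (g ^ j) n + of_real lam * fps_nth (g ^ k) n)"
      by simp
    then have "of_nat (Suc n) * fps_nth (g ^ k) (Suc n)
        = of_real (stirling1_rec lam (Suc n) k) * fact k / fact n"
      unfolding Suc.IH by (simp add: Suc field_simps del: of_nat_Suc)
    then show ?thesis
      by (simp add: field_simps del: of_nat_Suc stirling1_rec.simps)
  qed
qed

lemma has_fps_expansion_Ln_1_plus: "(\<lambda>z::complex. ln (1 + z)) has_fps_expansion fps_ln 1"
proof -
  have "eventually (\<lambda>z::complex. z \<in> ball 0 1) (nhds 0)"
    by (intro eventually_nhds_in_open) auto
  then have "eventually (\<lambda>z::complex. eval_fps (fps_ln 1) z = ln (1 + z)) (nhds 0)"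
  proof eventually_elim
    case (elim z)
    \<comment> \<open>At n = 0 the coefficient in \<open>Ln_series\<close> is a division by zero,
      hence 0, which agrees with the constant term of \<open>fps_ln\<close>.\<close>
    then have "(\<lambda>n. fps_nth (fps_ln 1) n * z ^ n) sums ln (1 + z)"
      by (intro sums_cong[THEN iffD1, OF _ Ln_series]) (auto simp: fps_ln_nth gr0_conv_Suc)
    then show ?case by (simp add: eval_fps_def sums_iff)
  qed
  then show ?thesis by (simp add: has_fps_expansion_def)
qed

lemma fps_deriv_fps_ln_1: "(1 + fps_X) * fps_deriv (fps_ln 1 :: complex fps) = 1"
  by (simp add: fps_ln_deriv inverse_mult_eq_1')

lemma fps_deriv_fps_binomial:
  "(1 + fps_X) * fps_deriv (fps_binomial c) = fps_const c * fps_binomial (c :: complex)"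
  by (simp add: fps_binomial_deriv fps_divide_unit inverse_mult_eq_1' mult.commute mult.left_commute)

section \<open>Expectation of the degenerate exponential\<close>

text \<open>With c = 1 - ln (1 + lam t) / lam, the integrand is exp (-c x) on the half-line, which
  is 1 / c times the exponential density of rate c, and that density has total mass 1.\<close>

lemma expectation_deg_exp_exponential:
  assumes "prob_space M" and D: "distributed M lborel Y (exponential_density 1)"
    and t: "1 + lam * t > 0" and pos: "1 - ln (1 + lam * t) / lam > 0"
  shows "prob_space.expectation M (\<lambda>\<omega>. deg_exp lam (Y \<omega>) t)
    = 1 / (1 - ln (1 + lam * t) / lam)"
proof -
  define c where "c = 1 - ln (1 + lam * t) / lam"
  have c: "c > 0" using pos by (simp add: c_def)
  have "prob_space.expectation M (\<lambda>\<omega>. deg_exp lam (Y \<omega>) t)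
      = (\<integral>x. exponential_density 1 x * deg_exp lam x t \<partial>lborel)"
    by (subst distributed_integral[OF D]) (auto simp: deg_exp_def exponential_density_def)
  also have "\<dots> = (\<integral>x. 1 / c * exponential_density c x \<partial>lborel)"
  proof (intro Bochner_Integration.integral_cong refl)
    fix x
    have "exp (- x) * exp (x / lam * ln (1 + lam * t)) = exp (- (x * c))"
      by (simp add: c_def exp_add[symmetric] algebra_simps)
    then show "exponential_density 1 x * deg_exp lam x t = 1 / c * exponential_density c x"
      using t c by (simp add: exponential_density_def deg_exp_def powr_def)
  qed
  also have "\<dots> = 1 / c * (\<integral>x. exponential_density c x \<partial>lborel)"
    by simp
  also have "(\<integral>x. exponential_density c x \<partial>lborel) = 1"
  proof -
    interpret E: prob_space "density lborel (exponential_density c)"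
      using c by (rule prob_space_exponential_density)
    have "(\<integral>x. exponential_density c x * 1 \<partial>lborel) = (\<integral>x. 1 \<partial>density lborel (exponential_density c))"
      using c by (subst integral_density) (auto simp: exponential_density_nonneg)
    then show ?thesis using E.prob_space by simp
  qed
  finally show ?thesis by (simp add: c_def)
qed

section \<open>The generating function as a composition of power series\<close>

lemma filterlim_complex_of_real_nhds_0: "filterlim complex_of_real (nhds 0) (nhds 0)"
proof -
  have "((\<lambda>x::real. complex_of_real x) \<longlongrightarrow> of_real 0) (nhds 0)"
    by (intro tendsto_of_real filterlim_ident)
  then show ?thesis by simp
qed

text \<open>The expansion is obtained for complex arguments and then restricted to real t near 0,
  where \<open>ln\<close> and \<open>powr\<close> take their real values. The sign (-1)^(k + l)
  collects the outer minus of -g (-s) and the inner one.\<close>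

lemma eventually_sums_deg_log_expectation:
  assumes "prob_space M" and D: "distributed M lborel Y (exponential_density 1)"
    and lam: "lam \<noteq> 0"
  shows "\<forall>\<^sub>F t in nhds 0.
    (\<lambda>n. (\<Sum>l\<le>n. (- 1) ^ (k + l) * stirling1_rec lam l k * stirling1_rec 0 n l * lam ^ (n - l))
            * t ^ n / fact n) sums
      (1 / fact k * deg_log (- lam) (prob_space.expectation M (\<lambda>\<omega>. deg_exp lam (Y \<omega>) t)) ^ k)"
proof -
  define c where "c = complex_of_real lam"
  have [simp]: "c \<noteq> 0" using lam by (simp add: c_def)
  \<comment> \<open>\<open>S\<close> will expand -ln (1 + c z) / c and \<open>G\<close> will expand
    ((1 + u) powr c - 1) / c, so that \<open>F\<close> expands \<open>f\<close>.\<close>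
  define H where "H = (fps_ln 1 :: complex fps)"
  define L where "L = H oo (fps_const c * fps_X)"
  define S where "S = fps_const (- 1 / c) * L"
  define G where "G = fps_const (1 / c) * (fps_binomial c - 1)"
  define F where "F = fps_const (1 / fact k) * (- (G oo S)) ^ k"
  define f where "f = (\<lambda>z. 1 / fact k * (- (1 / c * ((1 + (- 1 / c) * ln (1 + c * z)) powr c - 1))) ^ k)"
  have H: "(\<lambda>z. ln (1 + z)) has_fps_expansion H"
    unfolding H_def by (rule has_fps_expansion_Ln_1_plus)
  have "((\<lambda>z. ln (1 + z)) \<circ> (\<lambda>z. c * z)) has_fps_expansion L"
    unfolding L_def by (intro has_fps_expansion_compose H fps_expansion_intros) simp
  then have S: "(\<lambda>z. (- 1 / c) * ln (1 + c * z)) has_fps_expansion S"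
    unfolding S_def o_def by (intro fps_expansion_intros)
  have S0: "fps_nth S 0 = 0"
    by (simp add: S_def L_def H_def)
  have "(\<lambda>z. 1 / c * ((1 + z) powr c - 1)) has_fps_expansion G"
    unfolding G_def by (intro fps_expansion_intros)
  from has_fps_expansion_compose[OF this S S0]
  have "(\<lambda>z. - (1 / c * ((1 + (- 1 / c) * ln (1 + c * z)) powr c - 1))) has_fps_expansion - (G oo S)"
    unfolding o_def by (rule has_fps_expansion_minus)
  \<comment> \<open>The k-th power is taken as a product of k equal factors.\<close>
  from has_fps_expansion_prod[of "{..<k}" "\<lambda>_. _" "\<lambda>_. _", OF this]
  have f: "f has_fps_expansion F"
    unfolding f_def F_def by (intro has_fps_expansion_cmult_left) simp
  have "fps_nth G 0 = 0"
    by (simp add: G_def)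
  moreover have "(1 + fps_X) * fps_deriv G = 1 + fps_const (of_real lam) * G"
  proof -
    have "(1 + fps_X) * fps_deriv G = fps_const (1 / c) * ((1 + fps_X) * fps_deriv (fps_binomial c))"
      by (simp add: G_def algebra_simps)
    also have "\<dots> = fps_binomial c"
      unfolding fps_deriv_fps_binomial by (simp add: mult.assoc[symmetric])
    also have "\<dots> = 1 + fps_const c * G"
      by (simp add: G_def mult.assoc[symmetric])
    finally show ?thesis by (simp add: c_def)
  qed
  ultimately have G: "fps_nth (G ^ k) n = of_real (stirling1_rec lam n k) * fact k / fact n" for n
    by (rule fps_nth_power_stirling1_rec)
  have Hp: "fps_nth (H ^ l) n = of_real (stirling1_rec 0 n l) * fact l / fact n" for l n
    by (rule fps_nth_power_stirling1_rec) (simp_all add: H_def fps_deriv_fps_ln_1)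
  \<comment> \<open>Scaling the argument by c multiplies coefficient n by c^n; together with (-1 /
    c)^l this leaves (-1)^l c^(n - l) for l \<le> n.\<close>
  have Sp: "fps_nth (S ^ l) n = (- 1 / c) ^ l * c ^ n * fps_nth (H ^ l) n" for l n
  proof -
    have "S ^ l = fps_const ((- 1 / c) ^ l) * (H ^ l oo (fps_const c * fps_X))"
      unfolding S_def L_def
      by (simp add: power_mult_distrib fps_compose_power fps_const_power)
    then show ?thesis by (simp add: fps_compose_linear)
  qed
  have coeff: "fps_nth F n = of_real ((\<Sum>l\<le>n. (- 1) ^ (k + l) * stirling1_rec lam l k
      * stirling1_rec 0 n l * lam ^ (n - l)) / fact n)" for n
  proof -
    have "(- (G oo S)) ^ k = fps_const ((- 1) ^ k) * (G ^ k oo S)"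
      by (simp add: power_minus[of "G oo S"] fps_compose_power[OF S0] fps_const_power[symmetric]
          fps_const_neg[symmetric] del: fps_const_power fps_const_neg)
    then have "fps_nth F n = (- 1) ^ k / fact k * (\<Sum>l\<le>n. fps_nth (G ^ k) l * fps_nth (S ^ l) n)"
      by (simp add: F_def fps_compose_nth atLeast0AtMost)
    also have "\<dots> = (\<Sum>l\<le>n. of_real ((- 1) ^ (k + l) * stirling1_rec lam l k
      * stirling1_rec 0 n l * lam ^ (n - l) / fact n))"
      unfolding sum_distrib_left
    proof (intro sum.cong refl)
      fix l assume "l \<in> {..n}"
      then have "c ^ n = c ^ l * c ^ (n - l)"
        by (simp add: power_add[symmetric])
      moreover have "(- 1 / c) ^ l = (- 1) ^ l / c ^ l"
        by (simp only: power_divide)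
      ultimately show "(- 1) ^ k / fact k * (fps_nth (G ^ k) l * fps_nth (S ^ l) n)
        = of_real ((- 1) ^ (k + l) * stirling1_rec lam l k
            * stirling1_rec 0 n l * lam ^ (n - l) / fact n)"
        using lam unfolding G Hp Sp by (simp add: power_add c_def)
    qed
    finally show ?thesis
      by (simp add: sum_divide_distrib)
  qed
  have "eventually (\<lambda>z. z \<in> eball 0 (fps_conv_radius F)) (nhds 0)"
    using f by (intro eventually_nhds_in_open) (auto simp: has_fps_expansion_def zero_ereal_def)
  moreover have "eventually (\<lambda>z. eval_fps F z = f z) (nhds 0)"
    using f by (simp add: has_fps_expansion_def)
  ultimately have "eventually (\<lambda>z. (\<lambda>n. fps_nth F n * z ^ n) sums f z) (nhds 0)"
  proof eventually_elim
    case (elim z)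
    then show ?case
      using sums_eval_fps[of z F] by (simp add: in_eball_iff)
  qed
  then have "\<forall>\<^sub>F t in nhds 0. (\<lambda>n. fps_nth F n * complex_of_real t ^ n) sums f (of_real t)"
    using filterlim_complex_of_real_nhds_0 by (auto simp: filterlim_iff)
  \<comment> \<open>This quantity and the next one are continuous at t = 0 with value 1.\<close>
  moreover have "\<forall>\<^sub>F t in nhds 0. 1 + lam * t > 0"
    by (rule order_tendstoD(1)[of _ "1 + lam * 0"]) (auto intro!: tendsto_eq_intros filterlim_ident)
  moreover have "\<forall>\<^sub>F t in nhds 0. 1 - ln (1 + lam * t) / lam > 0"
    by (rule order_tendstoD(1)[of _ "1 - ln (1 + lam * 0) / lam"])
      (use lam in \<open>auto intro!: tendsto_eq_intros filterlim_ident\<close>)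
  ultimately show ?thesis
  proof eventually_elim
    case (elim t)
    have "f (of_real t) = of_real (1 / fact k *
        (- (1 / lam * ((1 - ln (1 + lam * t) / lam) powr lam - 1))) ^ k)"
    proof -
      have "ln (1 + c * of_real t) = of_real (ln (1 + lam * t))"
        using Ln_of_real[OF elim(2)] by (simp add: c_def)
      then have "1 + (- 1 / c) * ln (1 + c * of_real t) = of_real (1 - ln (1 + lam * t) / lam)"
        by (simp add: c_def)
      then have "(1 + (- 1 / c) * ln (1 + c * of_real t)) powr c
          = of_real ((1 - ln (1 + lam * t) / lam) powr lam)"
        using elim(3) by (simp only: c_def powr_of_real less_imp_le)
      then show ?thesis
        unfolding f_def by (simp only:) (simp add: c_def)
    qed
    \<comment> \<open>For w > 0, (1 / w) powr (-lam) = w powr lam.\<close>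
    also have "- (1 / lam * ((1 - ln (1 + lam * t) / lam) powr lam - 1))
        = deg_log (- lam) (1 / (1 - ln (1 + lam * t) / lam))"
      using elim(3) by (simp add: deg_log_def powr_divide powr_minus_divide)
    also have "1 / (1 - ln (1 + lam * t) / lam)
        = prob_space.expectation M (\<lambda>\<omega>. deg_exp lam (Y \<omega>) t)"
      using expectation_deg_exp_exponential[OF assms(1,2) elim(2,3)] by simp
    finally have "(\<lambda>n. complex_of_real ((\<Sum>l\<le>n. (- 1) ^ (k + l) * stirling1_rec lam l k
      * stirling1_rec 0 n l * lam ^ (n - l)) / fact n * t ^ n)) sums
      of_real (1 / fact k * deg_log (- lam) (prob_space.expectation M (\<lambda>\<omega>. deg_exp lam (Y \<omega>) t)) ^ k)"
      using elim(1) by (simp only: coeff of_real_mult[symmetric] of_real_power[symmetric])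
    then show ?case
      by (simp only: sums_of_real_iff times_divide_eq_left)
  qed
qed

section \<open>Uniqueness of coefficients and the explicit formula\<close>

text \<open>Zeros are isolated: a nonzero coefficient of positive index would make the sum nonzero
  on a punctured ball around 0.\<close>

lemma sums_0_imp_coeff_eq_0:
  fixes c :: "nat \<Rightarrow> real"
  assumes "\<forall>\<^sub>F t in nhds 0. (\<lambda>n. c n * t ^ n) sums 0"
  shows "c m = 0"
proof (rule ccontr)
  assume m: "c m \<noteq> 0"
  obtain r where r: "r > 0" "\<And>t. dist t 0 < r \<Longrightarrow> (\<lambda>n. c n * t ^ n) sums 0"
    using assms unfolding eventually_nhds_metric by blast
  \<comment> \<open>\<open>powser_0_nonzero\<close> asks for a positive index, so index 0 is settled
    by evaluation at t = 0.\<close>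
  have "c 0 = 0"
    using r(2)[of 0] r(1) powser_sums_zero_iff[of c 0] by simp
  with m have "m > 0" by (cases m) auto
  show False
  proof (rule powser_0_nonzero[of r 0 c "\<lambda>_. 0" m])
    show "False" if "0 < s" "\<And>z::real. z \<in> cball 0 s - {0} \<Longrightarrow> (0::real) \<noteq> 0" for s :: real
      using that(1) that(2)[of s] by simp
  qed (use r m \<open>m > 0\<close> in auto)
qed

text \<open>Uniqueness in the definite description: the difference of two admissible sequences
  gives, up to nonzero factors, the coefficients of a power series vanishing near 0.\<close>

lemma prob_deg_stirling1_exponential:
  assumes "prob_space M" and "distributed M lborel Y (exponential_density 1)"
    and "lam \<noteq> 0"
  shows "prob_deg_stirling1 M Y lam n k =
    (\<Sum>l=k..n. (- 1) ^ (n - l) * stirling1_rec lam l k * stirling1_rec 0 n l * lam ^ (n - l))"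
proof -
  define b where "b = (\<lambda>n. \<Sum>l=k..n. (- 1) ^ (n - l) * stirling1_rec lam l k * stirling1_rec 0 n l * lam ^ (n - l))"
  define g where "g = (\<lambda>t. 1 / fact k * deg_log (- lam) (prob_space.expectation M (\<lambda>\<omega>. deg_exp lam (Y \<omega>) t)) ^ k)"
  have b_eq: "(- 1) ^ (n - k) * b n
      = (\<Sum>l\<le>n. (- 1) ^ (k + l) * stirling1_rec lam l k * stirling1_rec 0 n l * lam ^ (n - l))" for n
  proof -
    have "(- 1) ^ (n - k) * b n
      = (\<Sum>l=k..n. (- 1) ^ (k + l) * stirling1_rec lam l k * stirling1_rec 0 n l * lam ^ (n - l))"
      unfolding b_def sum_distrib_left
    proof (intro sum.cong refl)
      fix l assume "l \<in> {k..n}"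
      \<comment> \<open>Since k \<le> l \<le> n, both subtractions are exact and the exponents have
        equal parity.\<close>
      then have "(- 1 :: real) ^ (n - k) * (- 1) ^ (n - l) = (- 1) ^ (k + l)"
        by (auto simp: minus_one_power_iff)
      then show "(- 1) ^ (n - k) * ((- 1) ^ (n - l) * stirling1_rec lam l k * stirling1_rec 0 n l * lam ^ (n - l))
        = (- 1) ^ (k + l) * stirling1_rec lam l k * stirling1_rec 0 n l * lam ^ (n - l)"
        by (simp only: mult.assoc[symmetric])
    qed
    also have "\<dots> = (\<Sum>l\<le>n. (- 1) ^ (k + l) * stirling1_rec lam l k * stirling1_rec 0 n l * lam ^ (n - l))"
      by (rule sum.mono_neutral_left) (auto simp: stirling1_rec_eq_0)
    finally show ?thesis .
  qed
  have b_sums: "\<forall>\<^sub>F t in nhds 0. (\<lambda>n. (- 1) ^ (n - k) * b n * t ^ n / fact n) sums g t"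
    unfolding b_eq g_def by (rule eventually_sums_deg_log_expectation[OF assms])
  have "(THE a. (\<forall>n<k. a n = 0) \<and>
      (\<forall>\<^sub>F t in nhds 0. (\<lambda>n. (- 1) ^ (n - k) * a n * t ^ n / fact n) sums g t)) = b"
  proof (rule the_equality)
    show "(\<forall>n<k. b n = 0) \<and>
      (\<forall>\<^sub>F t in nhds 0. (\<lambda>n. (- 1) ^ (n - k) * b n * t ^ n / fact n) sums g t)"
      \<comment> \<open>For n < k the sum defining \<open>b n\<close> is empty.\<close>
      using b_sums by (simp add: b_def)
  next
    fix a
    assume a: "(\<forall>n<k. a n = 0) \<and>
      (\<forall>\<^sub>F t in nhds 0. (\<lambda>n. (- 1) ^ (n - k) * a n * t ^ n / fact n) sums g t)"
    from b_sums conjunct2[OF a]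
    have "\<forall>\<^sub>F t in nhds 0. (\<lambda>n. (- 1) ^ (n - k) * (a n - b n) / fact n * t ^ n) sums 0"
    proof eventually_elim
      case (elim t)
      from sums_diff[OF elim(2) elim(1)] show ?case
        by (simp add: algebra_simps diff_divide_distrib)
    qed
    then have "(- 1) ^ (n - k) * (a n - b n) / fact n = 0" for n
      by (rule sums_0_imp_coeff_eq_0)
    then show "a = b" by (simp add: fun_eq_iff)
  qed
  then show ?thesis
    by (simp add: prob_deg_stirling1_def g_def b_def)
qed

section \<open>The limit as \<open>lam\<close> tends to 0\<close>

lemma continuous_on_stirling1_rec: "continuous_on UNIV (\<lambda>lam. stirling1_rec lam n k)"
proof (induction n arbitrary: k)
  case (Suc n)
  then show ?case by (cases "k = 0") (auto intro!: continuous_intros)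
qed simp

theorem theorem3p5:
  fixes M :: "'a measure" and Y :: "'a \<Rightarrow> real" and n k :: nat
  assumes "prob_space M"
    and "distributed M lborel Y (exponential_density 1)"
    and "k \<le> n"
  shows "(\<forall>lam::real. lam \<noteq> 0 \<longrightarrow>
            prob_deg_stirling1 M Y lam n k =
              (\<Sum>l=k..n. (- 1) ^ (n - l) * deg_stirling1 lam l k * stirling1 n l * lam ^ (n - l)))
       \<and> ((\<lambda>lam. prob_deg_stirling1 M Y lam n k) \<longlongrightarrow> stirling1 n k) (at 0)"
proof
  let ?R = "\<lambda>lam. \<Sum>l=k..n. (- 1) ^ (n - l) * stirling1_rec lam l k * stirling1_rec 0 n l * lam ^ (n - l)"
  show "\<forall>lam::real. lam \<noteq> 0 \<longrightarrow> prob_deg_stirling1 M Y lam n k =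
      (\<Sum>l=k..n. (- 1) ^ (n - l) * deg_stirling1 lam l k * stirling1 n l * lam ^ (n - l))"
    using prob_deg_stirling1_exponential[OF assms(1,2)]
    by (simp add: deg_stirling1_eq_rec stirling1_eq_rec)
  have diag: "stirling1_rec 0 m m = 1" for m
    by (induction m) (auto simp: stirling1_rec_eq_0)
  \<comment> \<open>The factor 0^(n - l) is 1 for l = n and 0 otherwise.\<close>
  have "?R 0 = (\<Sum>l=k..n. if l = n then stirling1_rec 0 n k else 0)"
    by (intro sum.cong) (auto simp: diag)
  then have R0: "?R 0 = stirling1 n k"
    using assms(3) by (simp add: stirling1_eq_rec)
  have "continuous_on UNIV ?R"
    by (intro continuous_intros continuous_on_stirling1_rec)
  then have "(?R \<longlongrightarrow> ?R 0) (at 0)"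
    by (simp add: continuous_on_def)
  then have "(?R \<longlongrightarrow> stirling1 n k) (at 0)"
    unfolding R0 .
  \<comment> \<open>The formula is available for \<open>lam\<close> other than 0 only, which
    suffices for a limit over punctured neighbourhoods.\<close>
  then show "((\<lambda>lam. prob_deg_stirling1 M Y lam n k) \<longlongrightarrow> stirling1 n k) (at 0)"
    by (rule Lim_transform_eventually)
      (auto simp: eventually_at_filter prob_deg_stirling1_exponential[OF assms(1,2)])
qed

end
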